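(* Let $\mathcal A$ be a unital associative algebra over $\mathbb C$ and let $L^{\pm}=(L^{\pm}_{ij})_{i,j=1,2}$ be two $2\times 2$ matrices with entries in $\mathcal A$. For $x\neq 0$ put $L(x)=x^{-1/2}L^{+}+x^{1/2}L^{-}$. Then the three relations $$R^{+}L^{+}_1L^{+}_2=L^{+}_2L^{+}_1R^{+},\qquad R^{+}L^{-}_1L^{-}_2=L^{-}_2L^{-}_1R^{+},\qquad R^{+}L^{+}_1L^{-}_2=L^{-}_2L^{+}_1R^{+}$$ all hold if and only if $$R^{+}(x/y)\,L_1(x)\,L_2(y)=L_2(y)\,L_1(x)\,R^{+}(x/y)\qquad\text{for all nonzero }x,y\in\mathbb C .$$
   Context: Let $P$ be the permutation (flip) matrix on $\mathbb C^2\otimes\mathbb C^2$, with basis ordered $e_1\otimes e_1, e_1\otimes e_2, e_2\otimes e_1, e_2\otimes e_2$. Let $$R=\frac1{\sqrt2}\begin{pmatrix}1&0&0&1\\0&1&1&0\\0&1&-1&0\\-1&0&0&1\end{pmatrix},\qquad R^{+}=PRP,\qquad R^{-}=R^{-1},$$ and $R^{+}(x)=x^{-1/2}R^{+}+x^{1/2}R^{-}$ for $x\ne0$. Here $R^+(x)=PR(x)P$ with $R(x)=x^{-1/2}R+x^{1/2}(PRP)^{-1}$. For a $2\times2$ matrix $L$ with entries in $\mathcal A$, $L_1=L\otimes \mathbf 1$ and $L_2=\mathbf 1\otimes L$ are the $4\times 4$ matrices over $\mathcal A$ with $(L_1)_{(i,k),(j,l)}=L_{ij}\delta_{kl}$ and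 $(L_2)_{(i,k),(j,l)}=\delta_{ij}L_{kl}$. Products are products of matrices over $\mathcal A$; scalar matrices such as $R^{+}$ have entries in $\mathbb C$. For given $x,y$ square roots $x^{1/2},y^{1/2}$ are chosen and $(x/y)^{1/2}=x^{1/2}/y^{1/2}$ (the choices only affect overall signs). *)

theory Defs
  imports "HOL-Analysis.Analysis"
begin

text \<open>Unital associative algebras over the complex numbers, with an explicit scalar
  multiplication. The sort \<open>{ring, monoid_mult}\<close> is used instead of \<open>ring_1\<close>
  because the latter imposes \<open>0 \<noteq> 1\<close> and so excludes the zero algebra.\<close>

locale complex_unital_algebra = vector_space smul
  for smul :: "complex \<Rightarrow> 'a::{ring, monoid_mult} \<Rightarrow> 'a" +
  assumes scale_mult_left: "smul c (a * b) = smul c a * b"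
    and scale_mult_right: "smul c (a * b) = a * smul c b"

text \<open>The product \<open>**\<close> of the library requires \<open>semiring_1\<close>, hence \<open>0 \<noteq> 1\<close>;
  this is the same formula over a weaker sort.\<close>

definition mat_prod :: "'a::semiring_0 ^ 'n ^ 'm \<Rightarrow> 'a ^ 'p ^ 'n \<Rightarrow> 'a ^ 'p ^ 'm"
    (infixl \<open>\<odot>\<close> 70) where
  "A \<odot> B = (\<chi> i j. \<Sum>k\<in>UNIV. A $ i $ k * B $ k $ j)"

definition scale_mat :: "(complex \<Rightarrow> 'a \<Rightarrow> 'a) \<Rightarrow> complex \<Rightarrow> 'a ^ 'n ^ 'm \<Rightarrow> 'a ^ 'n ^ 'm" where
  "scale_mat smul c M = (\<chi> i j. smul c (M $ i $ j))"

definition embed_mat ::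
    "(complex \<Rightarrow> 'a::{ring, monoid_mult} \<Rightarrow> 'a) \<Rightarrow> complex ^ 'n ^ 'm \<Rightarrow> 'a ^ 'n ^ 'm" where
  "embed_mat smul M = (\<chi> i j. smul (M $ i $ j) 1)"

text \<open>Operators on the tensor square of the plane are matrices indexed by pairs \<open>(i, k)\<close>,
  standing for the basis vector \<open>e\<^sub>i \<otimes> e\<^sub>k\<close>; the elements of the index type \<open>2\<close>
  are \<open>1\<close> and \<open>2\<close> (where \<open>2 = 0\<close>). The function \<open>basis_pos\<close> is the position, counted
  from \<open>0\<close>, in the order \<open>(1,1), (1,2), (2,1), (2,2)\<close>.\<close>

definition basis_pos :: "2 \<times> 2 \<Rightarrow> nat" where
  "basis_pos p = (if fst p = 1 then 0 else 2) + (if snd p = 1 then 0 else 1)"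

definition flip_mat :: "complex ^ (2 \<times> 2) ^ (2 \<times> 2)" where
  "flip_mat = (\<chi> r c. if r = prod.swap c then 1 else 0)"

definition R_mat :: "complex ^ (2 \<times> 2) ^ (2 \<times> 2)" where
  "R_mat = (\<chi> r c. complex_of_real (1 / sqrt 2) *
     ([[ 1, 0,  0, 1],
       [ 0, 1,  1, 0],
       [ 0, 1, -1, 0],
       [-1, 0,  0, 1]] ! basis_pos r ! basis_pos c))"

definition R_plus :: "complex ^ (2 \<times> 2) ^ (2 \<times> 2)" where
  "R_plus = flip_mat ** R_mat ** flip_mat"

definition R_minus :: "complex ^ (2 \<times> 2) ^ (2 \<times> 2)" where
  "R_minus = matrix_inv R_mat"

text \<open>In the spectral-parameter dependent matrices \<open>R\<^sup>+(x)\<close> and \<open>L(x)\<close> the argument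
  \<open>s\<close> is the chosen square root of \<open>x\<close>.\<close>

definition R_plus_spec :: "complex \<Rightarrow> complex ^ (2 \<times> 2) ^ (2 \<times> 2)" where
  "R_plus_spec s = scale_mat (*) (inverse s) R_plus + scale_mat (*) s R_minus"

definition L_spec ::
    "(complex \<Rightarrow> 'a::{ring, monoid_mult} \<Rightarrow> 'a) \<Rightarrow> 'a ^ 2 ^ 2 \<Rightarrow> 'a ^ 2 ^ 2 \<Rightarrow> complex \<Rightarrow> 'a ^ 2 ^ 2"
  where
  "L_spec smul Lp Lm s = scale_mat smul (inverse s) Lp + scale_mat smul s Lm"

definition leg1 :: "'a::zero ^ 2 ^ 2 \<Rightarrow> 'a ^ (2 \<times> 2) ^ (2 \<times> 2)" where
  "leg1 L = (\<chi> r c. if snd r = snd c then L $ fst r $ fst c else 0)"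

definition leg2 :: "'a::zero ^ 2 ^ 2 \<Rightarrow> 'a ^ (2 \<times> 2) ^ (2 \<times> 2)" where
  "leg2 L = (\<chi> r c. if fst r = fst c then L $ snd r $ snd c else 0)"

end

theory Submission imports Defs begin

text \<open>Write \<open>D(M, K, L) = M K\<^sub>1 L\<^sub>2 - L\<^sub>2 K\<^sub>1 M\<close>, which is trilinear. With
  \<open>x = s\<^sup>2\<close> and \<open>y = t\<^sup>2\<close> the spectral relation is the vanishing of a Laurent polynomial in
  \<open>x, y\<close> whose coefficients are \<open>D(R\<^sup>\<plusminus>, L\<^sup>\<plusminus>, L\<^sup>\<plusminus>)\<close>, except that the constant term collects
  \<open>D(R\<^sup>+, L\<^sup>-, L\<^sup>+) + D(R\<^sup>-, L\<^sup>+, L\<^sup>-)\<close>. Three of the coefficients are the relations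
  in question. Conversely, conjugation by the flip \<open>P\<close> together with \<open>R\<^sup>- = R\<^sup>-\<^sup>1\<close> turns
  \<open>D(R\<^sup>+, K, L) = 0\<close> into \<open>D(R\<^sup>-, L, K) = 0\<close>, and the Hecke relation \<open>R\<^sup>+ + R\<^sup>- = \<surd>2 P\<close>
  makes the constant term vanish because \<open>D(P, K, L) + D(P, L, K) = 0\<close>.\<close>

section \<open>Matrices over a complex algebra\<close>

lemma mat_prod_assoc: "(A \<odot> B) \<odot> C = A \<odot> (B \<odot> C)"
proof -
  have "(\<Sum>k\<in>UNIV. (\<Sum>l\<in>UNIV. A $ i $ l * B $ l $ k) * C $ k $ j)
      = (\<Sum>l\<in>UNIV. A $ i $ l * (\<Sum>k\<in>UNIV. B $ l $ k * C $ k $ j))" for i j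
    by (simp add: sum_distrib_left sum_distrib_right mult.assoc) (rule sum.swap)
  then show ?thesis
    by (simp add: mat_prod_def)
qed

lemma mat_prod_add_left: "(A + B) \<odot> C = A \<odot> C + B \<odot> C"
  by (simp add: mat_prod_def vec_eq_iff distrib_right sum.distrib)

lemma mat_prod_add_right: "A \<odot> (B + C) = A \<odot> B + A \<odot> C"
  by (simp add: mat_prod_def vec_eq_iff distrib_left sum.distrib)

lemma leg1_add: "leg1 (A + B :: 'a::monoid_add ^ 2 ^ 2) = leg1 A + leg1 B"
  by (simp add: leg1_def vec_eq_iff)

lemma leg2_add: "leg2 (A + B :: 'a::monoid_add ^ 2 ^ 2) = leg2 A + leg2 B"
  by (simp add: leg2_def vec_eq_iff)

definition braid_defect ::
    "'a::ring ^ (2 \<times> 2) ^ (2 \<times> 2) \<Rightarrow> 'a ^ 2 ^ 2 \<Rightarrow> 'a ^ 2 ^ 2 \<Rightarrow> 'a ^ (2 \<times> 2) ^ (2 \<times> 2)" where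
  "braid_defect M K L = M \<odot> leg1 K \<odot> leg2 L - leg2 L \<odot> leg1 K \<odot> M"

lemma braid_defect_eq_0_iff:
  "braid_defect M K L = 0 \<longleftrightarrow> M \<odot> leg1 K \<odot> leg2 L = leg2 L \<odot> leg1 K \<odot> M"
  by (simp add: braid_defect_def)

lemma braid_defect_add:
  "braid_defect (M + N) K L = braid_defect M K L + braid_defect N K L"
  "braid_defect M (K + K') L = braid_defect M K L + braid_defect M K' L"
  "braid_defect M K (L + L') = braid_defect M K L + braid_defect M K L'"
  by (simp_all add: braid_defect_def leg1_add leg2_add mat_prod_add_left mat_prod_add_right)

context complex_unital_algebra
begin

text \<open>Makes the coefficient comparison for vector spaces applicable to polynomials whose
  coefficients are matrices over the algebra.\<close>

lemma vector_space_scale_mat: "vector_space (scale_mat smul)"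
  by unfold_locales
    (simp_all add: scale_mat_def vec_eq_iff scale_right_distrib scale_left_distrib)

lemma mat_prod_scale_left: "scale_mat smul c A \<odot> B = scale_mat smul c (A \<odot> B)"
  by (simp add: mat_prod_def scale_mat_def vec_eq_iff scale_sum_right scale_mult_left)

lemma mat_prod_scale_right: "A \<odot> scale_mat smul c B = scale_mat smul c (A \<odot> B)"
  by (simp add: mat_prod_def scale_mat_def vec_eq_iff scale_sum_right scale_mult_right)

lemma leg1_scale: "leg1 (scale_mat smul c A) = scale_mat smul c (leg1 A)"
  by (simp add: leg1_def scale_mat_def vec_eq_iff)

lemma leg2_scale: "leg2 (scale_mat smul c A) = scale_mat smul c (leg2 A)"
  by (simp add: leg2_def scale_mat_def vec_eq_iff)

lemma braid_defect_scale:
  "braid_defect (scale_mat smul c M) K L = scale_mat smul c (braid_defect M K L)"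
  "braid_defect M (scale_mat smul c K) L = scale_mat smul c (braid_defect M K L)"
  "braid_defect M K (scale_mat smul c L) = scale_mat smul c (braid_defect M K L)"
proof -
  interpret mat: vector_space "scale_mat smul :: complex \<Rightarrow> 'a ^ (2 \<times> 2) ^ (2 \<times> 2) \<Rightarrow> _"
    by (rule vector_space_scale_mat)
  show "braid_defect (scale_mat smul c M) K L = scale_mat smul c (braid_defect M K L)"
    "braid_defect M (scale_mat smul c K) L = scale_mat smul c (braid_defect M K L)"
    "braid_defect M K (scale_mat smul c L) = scale_mat smul c (braid_defect M K L)"
    by (simp_all add: braid_defect_def leg1_scale leg2_scale mat_prod_scale_left
        mat_prod_scale_right mat.scale_right_diff_distrib)
qed

lemma embed_mat_add: "embed_mat smul (A + B) = embed_mat smul A + embed_mat smul B"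
  by (simp add: embed_mat_def vec_eq_iff scale_left_distrib)

lemma embed_mat_scale: "embed_mat smul (scale_mat (*) c A) = scale_mat smul c (embed_mat smul A)"
  by (simp add: embed_mat_def scale_mat_def vec_eq_iff)

lemma embed_mat_mult: "embed_mat smul (A ** B) = embed_mat smul A \<odot> embed_mat smul B"
  by (simp add: embed_mat_def mat_prod_def matrix_matrix_mult_def vec_eq_iff scale_sum_left
      flip: scale_mult_left)

lemma embed_mat_one_left: "embed_mat smul (mat 1) \<odot> A = A"
proof -
  have "smul (if i = k then 1 else 0) 1 * A $ k $ j = (if i = k then A $ k $ j else 0)" for i j k
    by (simp flip: scale_mult_left)
  then show ?thesis
    by (simp add: embed_mat_def mat_prod_def mat_def vec_eq_iff)
qed

lemma embed_mat_one_right: "A \<odot> embed_mat smul (mat 1) = A"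
proof -
  have "A $ i $ k * smul (if k = j then 1 else 0) 1 = (if k = j then A $ i $ k else 0)" for i j k
    by (simp flip: scale_mult_right)
  then show ?thesis
    by (simp add: embed_mat_def mat_prod_def mat_def vec_eq_iff)
qed

end

section \<open>The flip and the Hecke relation\<close>

lemma sum_pair_2: "(\<Sum>p\<in>(UNIV :: (2 \<times> 2) set). f p) = f (1,1) + f (1,2) + f (2,1) + f (2,2)"
proof -
  have "(UNIV :: (2 \<times> 2) set) = {(1,1), (1,2), (2,1), (2,2)}"
    by (auto simp: UNIV_2 UNIV_Times_UNIV[symmetric] simp del: UNIV_Times_UNIV)
  then have "(\<Sum>p\<in>UNIV. f p) = (\<Sum>p\<in>{(1,1), (1,2), (2,1), (2,2)}. f p)"
    by (simp only:)
  then show ?thesis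
    by (simp add: add.assoc)
qed

lemma flip_mat_squared: "flip_mat ** flip_mat = mat 1"
  by (simp add: flip_mat_def matrix_matrix_mult_def mat_def vec_eq_iff sum_pair_2
      forall_2)

lemma (in complex_unital_algebra) flip_leg1:
  "embed_mat smul flip_mat \<odot> leg1 L = leg2 L \<odot> embed_mat smul flip_mat"
  by (simp add: flip_mat_def embed_mat_def leg1_def leg2_def mat_prod_def vec_eq_iff
      sum_pair_2 forall_2 flip: scale_mult_left scale_mult_right)

lemma R_plus_nth: "R_plus $ r $ c = R_mat $ prod.swap r $ prod.swap c"
proof -
  \<comment> \<open>Isolating the summation index \<open>k\<close> lets the sum against the flip
    collapse to a single term.\<close>
  have 1: "r = prod.swap k \<longleftrightarrow> k = prod.swap r" for r k :: "2 \<times> 2"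
    by (metis swap_swap)
  show ?thesis
    by (simp add: R_plus_def flip_mat_def matrix_matrix_mult_def 1[of r] if_distrib[of "(*) _"]
        if_distrib[of "\<lambda>u. u * _"] cong: if_cong)
qed

text \<open>The candidate for the inverse of \<open>R_mat\<close>, solved from the Hecke relation.
  Once it is known to be that inverse, the relation holds by construction.\<close>

definition R_hecke :: "complex ^ (2 \<times> 2) ^ (2 \<times> 2)" where
  "R_hecke = scale_mat (*) (complex_of_real (sqrt 2)) flip_mat - R_plus"

text \<open>\<open>R_mat\<close> is real orthogonal and \<open>R_hecke\<close> is its
  transpose.\<close>

lemma R_mat_hecke: "R_mat ** R_hecke = mat 1" "R_hecke ** R_mat = mat 1"
proof -
  define h where "h = complex_of_real (1 / sqrt 2)"
  \<comment> \<open>With \<surd>2 written as 2h, the entries of both factors are integer multiples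
    of h, and h^2 = 1/2 is the only relation the check uses.\<close>
  have "sqrt 2 = 2 * (1 / sqrt 2)"
    by (simp add: real_div_sqrt)
  then have sqrt_2: "complex_of_real (sqrt 2) = 2 * h"
    by (metis h_def of_real_mult of_real_numeral)
  have "h * h = 1 / 2"
    by (simp add: h_def flip: of_real_mult)
  then have h: "h * h = 1 / 2" "h * (h * u) = u / 2" for u
    by (simp_all flip: mult.assoc)
  have R: "R_mat $ r $ c = h * ([[1, 0, 0, 1], [0, 1, 1, 0], [0, 1, -1, 0], [-1, 0, 0, 1]]
      ! basis_pos r ! basis_pos c)" for r c
    by (simp add: R_mat_def h_def)
  show "R_mat ** R_hecke = mat 1" "R_hecke ** R_mat = mat 1"
    unfolding R_hecke_def sqrt_2 vec_eq_iff matrix_matrix_mult_def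
    by (simp_all add: R_plus_nth R scale_mat_def flip_mat_def basis_pos_def
        mat_def forall_2 sum_pair_2 algebra_simps h)
qed

text \<open>\<open>matrix_inv\<close> is a choice operator. \<open>R_hecke\<close> witnesses that a
  two-sided inverse exists, and uniqueness of inverses identifies the chosen one.\<close>

lemma R_minus_eq_hecke: "R_minus = R_hecke"
proof -
  have "R_mat ** R_minus = mat 1 \<and> R_minus ** R_mat = mat 1"
    unfolding R_minus_def matrix_inv_def by (rule someI[of _ R_hecke]) (simp add: R_mat_hecke)
  then show ?thesis
    by (metis R_mat_hecke(1) matrix_mul_assoc matrix_mul_lid matrix_mul_rid)
qed

lemma hecke_relation: "R_plus + R_minus = scale_mat (*) (complex_of_real (sqrt 2)) flip_mat"
  by (simp add: R_minus_eq_hecke R_hecke_def)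

context complex_unital_algebra
begin

text \<open>Follows from \<open>flip_leg1\<close> because P is an involution.\<close>

lemma flip_leg2: "embed_mat smul flip_mat \<odot> leg2 L = leg1 L \<odot> embed_mat smul flip_mat"
proof -
  let ?P = "embed_mat smul flip_mat"
  have PP: "?P \<odot> (?P \<odot> A) = A" "A \<odot> ?P \<odot> ?P = A" for A
    by (simp_all add: mat_prod_assoc embed_mat_one_left embed_mat_one_right flip_mat_squared
        flip: embed_mat_mult mat_prod_assoc[of ?P])
  have "?P \<odot> leg2 L = ?P \<odot> (leg2 L \<odot> ?P \<odot> ?P)"
    by (simp add: PP)
  also have "\<dots> = ?P \<odot> (?P \<odot> leg1 L \<odot> ?P)"
    by (simp add: flip_leg1)
  also have "\<dots> = leg1 L \<odot> ?P"
    by (simp add: mat_prod_assoc PP)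
  finally show ?thesis .
qed

text \<open>Moving P to the right gives D(P, K, L) = (K_2 L_1 - L_2 K_1) P, which is antisymmetric
  in K and L.\<close>

lemma braid_defect_flip:
  "braid_defect (embed_mat smul flip_mat) K L + braid_defect (embed_mat smul flip_mat) L K = 0"
  by (simp add: braid_defect_def flip_leg1 flip_leg2 mat_prod_assoc)

lemma braid_defect_R_minus:
  assumes "braid_defect (embed_mat smul R_plus) K L = 0"
  shows "braid_defect (embed_mat smul R_minus) L K = 0"
proof -
  let ?P = "embed_mat smul flip_mat" and ?R = "embed_mat smul R_mat"
    and ?Q = "embed_mat smul R_minus"
  have P_left: "?P \<odot> (?P \<odot> A) = A" for A
    by (simp add: embed_mat_one_left flip_mat_squared flip: embed_mat_mult mat_prod_assoc)
  have Q_left: "?Q \<odot> (?R \<odot> A) = A" for A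
    by (simp add: embed_mat_one_left R_mat_hecke R_minus_eq_hecke
        flip: embed_mat_mult mat_prod_assoc)
  have Q_right: "?R \<odot> ?Q = embed_mat smul (mat 1)"
    by (simp add: R_mat_hecke R_minus_eq_hecke flip: embed_mat_mult)
  have leg: "?P \<odot> (leg1 M \<odot> A) = leg2 M \<odot> (?P \<odot> A)" "?P \<odot> (leg2 M \<odot> A) = leg1 M \<odot> (?P \<odot> A)"
    for M A
    by (simp_all add: flip_leg1 flip_leg2 flip: mat_prod_assoc)
  have "?P \<odot> ?R \<odot> ?P \<odot> leg1 K \<odot> leg2 L = leg2 L \<odot> leg1 K \<odot> (?P \<odot> ?R \<odot> ?P)"
    using assms by (simp add: braid_defect_eq_0_iff R_plus_def embed_mat_mult)
  \<comment> \<open>Conjugation by P turns R^+ = PRP back into R and exchanges the two legs.\<close>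
  then have "?P \<odot> (?P \<odot> ?R \<odot> ?P \<odot> leg1 K \<odot> leg2 L) \<odot> ?P
      = ?P \<odot> (leg2 L \<odot> leg1 K \<odot> (?P \<odot> ?R \<odot> ?P)) \<odot> ?P"
    by simp
  moreover have "?P \<odot> ?P = embed_mat smul (mat 1)"
    by (simp add: flip_mat_squared flip: embed_mat_mult)
  ultimately have "?R \<odot> (leg2 K \<odot> leg1 L) = leg1 L \<odot> (leg2 K \<odot> ?R)"
    by (simp add: mat_prod_assoc leg P_left embed_mat_one_right)
  \<comment> \<open>Multiplying by R^- on both sides cancels R and leaves R^- at the opposite
    ends.\<close>
  then have "?Q \<odot> (?R \<odot> (leg2 K \<odot> leg1 L)) \<odot> ?Q = ?Q \<odot> (leg1 L \<odot> (leg2 K \<odot> ?R)) \<odot> ?Q"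
    by simp
  then show ?thesis
    by (simp add: braid_defect_eq_0_iff mat_prod_assoc Q_left Q_right embed_mat_one_right)
qed

end

section \<open>Comparing coefficients\<close>

text \<open>The nonzero points 1, -1 and 2 suffice: the first two give 2b = 0, then the values at 2
  and 1 differ by 3c. Characteristic zero allows division by 2 and 3.\<close>

lemma quadratic_eq_0_coeffs:
  fixes scale :: "'k::field_char_0 \<Rightarrow> 'b::ab_group_add \<Rightarrow> 'b"
  assumes "vector_space scale"
    and zero: "\<And>x. x \<noteq> 0 \<Longrightarrow> a + scale x b + scale (x\<^sup>2) c = 0"
  shows "a = 0" "b = 0" "c = 0"
proof -
  interpret vector_space scale by fact
  have at_1: "a + b + c = 0"
    using zero[of 1] by simp
  have at_minus_1: "a - b + c = 0"
    using zero[of "-1"] by simp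
  have "scale 2 b = (a + b + c) - (a - b + c)"
    using scale_left_distrib[of 1 1 b] by simp
  then show b: "b = 0"
    by (simp only: at_1 at_minus_1) simp
  have "scale 3 c = (a + scale 2 b + scale (2\<^sup>2) c) - (a + b + c)"
    using scale_left_distrib[of 3 1 c] b by simp
  then show c: "c = 0"
    using zero[of 2] at_1 by simp
  show "a = 0"
    using at_1 b c by simp
qed

text \<open>The coefficients a, b and d are those that will hold the three relations with
  R^+.\<close>

lemma laurent_eq_0_coeffs:
  fixes scale :: "'k::field_char_0 \<Rightarrow> 'b::ab_group_add \<Rightarrow> 'b"
  assumes "vector_space scale"
    and zero: "\<And>x y. x \<noteq> 0 \<Longrightarrow> y \<noteq> 0 \<Longrightarrow>
      scale (inverse x) a + scale (y / x) b + c + scale y d + scale (inverse y) e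
        + scale (x / y) f + scale x g = 0"
  shows "a = 0" "b = 0" "d = 0"
proof -
  interpret vector_space scale by fact
  \<comment> \<open>Multiplying by xy clears the denominators. For fixed y the result is quadratic
    in x, with coefficients that are polynomials in y.\<close>
  have in_x: "(scale y a + scale (y\<^sup>2) b) + scale x (e + scale y c + scale (y\<^sup>2) d)
      + scale (x\<^sup>2) (f + scale y g) = 0" if "x \<noteq> 0" "y \<noteq> 0" for x y
  proof -
    have "(scale y a + scale (y\<^sup>2) b) + scale x (e + scale y c + scale (y\<^sup>2) d)
        + scale (x\<^sup>2) (f + scale y g)
      = scale (x * y) (scale (inverse x) a + scale (y / x) b + c + scale y d
          + scale (inverse y) e + scale (x / y) f + scale x g)"
      using that by (simp add: scale_right_distrib field_simps power2_eq_square)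
    then show ?thesis
      using zero[OF that] by simp
  qed
  \<comment> \<open>The leading 0 casts this as a quadratic in y with zero constant term.\<close>
  have "0 + scale y a + scale (y\<^sup>2) b = 0" if "y \<noteq> 0" for y
    using quadratic_eq_0_coeffs(1)[OF assms(1) in_x[OF _ that]] by simp
  then show "a = 0" "b = 0"
    using quadratic_eq_0_coeffs(2,3)[OF assms(1)] by blast+
  have "e + scale y c + scale (y\<^sup>2) d = 0" if "y \<noteq> 0" for y
    using quadratic_eq_0_coeffs(2)[OF assms(1) in_x[OF _ that]] by simp
  then show "d = 0"
    using quadratic_eq_0_coeffs(3)[OF assms(1)] by blast
qed

text \<open>Each of the eight trilinear terms carries even powers of s and t, so only x = s^2 and y
  = t^2 survive. The factors (t/s) s (1/t) and (s/t) (1/s) t are both 1, which merges two terms into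
  the constant one.\<close>

lemma (in complex_unital_algebra) braid_defect_spec:
  fixes Lp Lm :: "'a ^ 2 ^ 2"
  assumes "s \<noteq> 0" "t \<noteq> 0"
  defines "Rp \<equiv> embed_mat smul R_plus" and "Rm \<equiv> embed_mat smul R_minus"
  shows "braid_defect (embed_mat smul (R_plus_spec (s / t))) (L_spec smul Lp Lm s)
      (L_spec smul Lp Lm t) =
    scale_mat smul (inverse (s\<^sup>2)) (braid_defect Rp Lp Lp)
    + scale_mat smul (t\<^sup>2 / s\<^sup>2) (braid_defect Rp Lp Lm)
    + (braid_defect Rp Lm Lp + braid_defect Rm Lp Lm)
    + scale_mat smul (t\<^sup>2) (braid_defect Rp Lm Lm)
    + scale_mat smul (inverse (t\<^sup>2)) (braid_defect Rm Lp Lp)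
    + scale_mat smul (s\<^sup>2 / t\<^sup>2) (braid_defect Rm Lm Lp)
    + scale_mat smul (s\<^sup>2) (braid_defect Rm Lm Lm)"
proof -
  interpret mat: vector_space "scale_mat smul :: complex \<Rightarrow> 'a ^ (2 \<times> 2) ^ (2 \<times> 2) \<Rightarrow> _"
    by (rule vector_space_scale_mat)
  show ?thesis
    using assms(1,2)
    by (simp add: R_plus_spec_def L_spec_def embed_mat_add embed_mat_scale braid_defect_add
        braid_defect_scale mat.scale_right_distrib field_simps power2_eq_square flip: Rp_def Rm_def)
qed

text \<open>\<open>rt\<close> is an arbitrary choice of square roots on the nonzero numbers, and
  \<open>rt x / rt y\<close> is the induced root of x/y.\<close>

theorem mainTheorem1:
  fixes smul :: "complex \<Rightarrow> 'a::{ring, monoid_mult} \<Rightarrow> 'a"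
    and Lp Lm :: "'a ^ 2 ^ 2"
    and rt :: "complex \<Rightarrow> complex"
  assumes "complex_unital_algebra smul"
    and "\<And>x. x \<noteq> 0 \<Longrightarrow> (rt x)\<^sup>2 = x"
  shows "(embed_mat smul R_plus \<odot> leg1 Lp \<odot> leg2 Lp = leg2 Lp \<odot> leg1 Lp \<odot> embed_mat smul R_plus \<and>
          embed_mat smul R_plus \<odot> leg1 Lm \<odot> leg2 Lm = leg2 Lm \<odot> leg1 Lm \<odot> embed_mat smul R_plus \<and>
          embed_mat smul R_plus \<odot> leg1 Lp \<odot> leg2 Lm = leg2 Lm \<odot> leg1 Lp \<odot> embed_mat smul R_plus)
     \<longleftrightarrow>
         (\<forall>x y. x \<noteq> 0 \<longrightarrow> y \<noteq> 0 \<longrightarrow>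
            embed_mat smul (R_plus_spec (rt x / rt y)) \<odot> leg1 (L_spec smul Lp Lm (rt x))
              \<odot> leg2 (L_spec smul Lp Lm (rt y))
          = leg2 (L_spec smul Lp Lm (rt y)) \<odot> leg1 (L_spec smul Lp Lm (rt x))
              \<odot> embed_mat smul (R_plus_spec (rt x / rt y)))"
proof -
  interpret complex_unital_algebra smul by fact
  interpret mat: vector_space "scale_mat smul :: complex \<Rightarrow> 'a ^ (2 \<times> 2) ^ (2 \<times> 2) \<Rightarrow> _"
    by (rule vector_space_scale_mat)
  let ?Rp = "embed_mat smul R_plus" and ?Rm = "embed_mat smul R_minus"
    and ?P = "embed_mat smul flip_mat"
  have rt_nonzero: "rt x \<noteq> 0" if "x \<noteq> 0" for x
    using assms(2)[OF that] that by auto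
  have spec: "braid_defect (embed_mat smul (R_plus_spec (rt x / rt y)))
      (L_spec smul Lp Lm (rt x)) (L_spec smul Lp Lm (rt y)) =
    scale_mat smul (inverse x) (braid_defect ?Rp Lp Lp)
    + scale_mat smul (y / x) (braid_defect ?Rp Lp Lm)
    + (braid_defect ?Rp Lm Lp + braid_defect ?Rm Lp Lm)
    + scale_mat smul y (braid_defect ?Rp Lm Lm)
    + scale_mat smul (inverse y) (braid_defect ?Rm Lp Lp)
    + scale_mat smul (x / y) (braid_defect ?Rm Lm Lp)
    + scale_mat smul x (braid_defect ?Rm Lm Lm)" (is "_ = ?laurent x y")
    if "x \<noteq> 0" "y \<noteq> 0" for x y
    using braid_defect_spec[OF rt_nonzero[OF that(1)] rt_nonzero[OF that(2)]]
    by (simp add: assms(2) that)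
  have hecke: "braid_defect ?Rp K L + braid_defect ?Rm K L
      = scale_mat smul (complex_of_real (sqrt 2)) (braid_defect ?P K L)" for K L
    by (simp add: hecke_relation embed_mat_scale braid_defect_scale
        flip: braid_defect_add embed_mat_add)
  have "?laurent x y = 0"
    if "braid_defect ?Rp Lp Lp = 0" "braid_defect ?Rp Lm Lm = 0" "braid_defect ?Rp Lp Lm = 0" for x y
  proof -
    have minus: "braid_defect ?Rm Lp Lp = 0" "braid_defect ?Rm Lm Lm = 0"
      "braid_defect ?Rm Lm Lp = 0"
      using that by (simp_all add: braid_defect_R_minus)
    \<comment> \<open>Adding two vanishing defects completes the constant term to two Hecke sums,
      which equal \<surd>2 times D(P, L^-, L^+) and D(P, L^+, L^-) and cancel.\<close>
    have "braid_defect ?Rp Lm Lp + braid_defect ?Rm Lp Lm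
        = (braid_defect ?Rp Lm Lp + braid_defect ?Rm Lm Lp)
          + (braid_defect ?Rp Lp Lm + braid_defect ?Rm Lp Lm)"
      using that minus by simp
    also have "\<dots> = 0"
      by (simp only: hecke braid_defect_flip mat.scale_zero_right flip: mat.scale_right_distrib)
    finally show ?thesis
      using that minus by simp
  qed
  moreover have "braid_defect ?Rp Lp Lp = 0 \<and> braid_defect ?Rp Lm Lm = 0
      \<and> braid_defect ?Rp Lp Lm = 0"
    if "\<And>x y. x \<noteq> 0 \<Longrightarrow> y \<noteq> 0 \<Longrightarrow> ?laurent x y = 0"
    using laurent_eq_0_coeffs[OF vector_space_scale_mat that] by blast
  ultimately have "braid_defect ?Rp Lp Lp = 0 \<and> braid_defect ?Rp Lm Lm = 0
      \<and> braid_defect ?Rp Lp Lm = 0 \<longleftrightarrow> (\<forall>x y. x \<noteq> 0 \<longrightarrow> y \<noteq> 0 \<longrightarrow> ?laurent x y = 0)"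
    by blast
  then show ?thesis
    by (simp only: braid_defect_eq_0_iff[symmetric] spec simp_thms cong: imp_cong)
qed

end
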